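(* Let $S=[Y,B_\alpha,\phi_{\alpha,\beta}]$ be a dual weak brace and let $z\in\mathcal{D}_r(S)$. Let $r_z:S\times S\to S\times S$ be the solution associated to $S$ deformed by $z$, i.e. $r_z(a,b)=\left(-a\circ z+a\circ b\circ z,\ (-a\circ z+a\circ b\circ z)^{-}\circ a\circ b\right)$. 1. If $Y$ is not bounded, or $Y$ is bounded with greatest element $1$ and $z\notin B_1$, then $r_z$ is not a strong semilattice of solutions defined on the sets $B_\alpha$, $\alpha\in Y$. 2. If $Y$ is bounded with greatest element $1$ and $r_z$ is a strong semilattice of solutions, then $z\in B_1$, the set $P=\{\phi_{1,\alpha}(z)\mid\alpha\in Y\}$ belongs to $\mathcal{B}(S)$, and $r_z$ is the strong semilattice of the solutions $r_{\phi_{1,\alpha}(z)}$ on the skew braces $B_\alpha$, $\alpha\in Y$.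
   Context: Skew brace: a set $B$ with groups $(B,+)$ (not necessarily abelian) and $(B,\circ)$ with $a\circ(b+c)=a\circ b-a+a\circ c$; $-a$, $a^-$ are the inverses for $+$, $\circ$; $\circ$ binds more tightly than $+,-$ (so $-a\circ z=-(a\circ z)$). Dual weak brace as a strong semilattice: $Y$ is a (lower) semilattice with operation written by juxtaposition, $\beta\le\alpha$ iff $\alpha\beta=\beta$; $\{B_\alpha\}_{\alpha\in Y}$ is a family of disjoint skew braces; for $\beta\le\alpha$, $\phi_{\alpha,\beta}:B_\alpha\to B_\beta$ is a skew brace homomorphism, with $\phi_{\alpha,\alpha}=\mathrm{id}$ and $\phi_{\beta,\gamma}\phi_{\alpha,\beta}=\phi_{\alpha,\gamma}$ for $\gamma\le\beta\le\alpha$. Then $S=[Y,B_\alpha,\phi_{\alpha,\beta}]$ is the disjoint union of the $B_\alpha$ with $a+b=\phi_{\alpha,\alpha\beta}(a)+\phi_{\beta,\alpha\beta}(b)$ and $a\circ b=\phi_{\alpha,\alpha\beta}(a)\circ\phi_{\beta,\alpha\beta}(b)$ for $a\in B_\alpha$, $b\in B_\beta$ (sums and products on the right taken in $B_{\alpha\beta}$); $-a$ and $a^-$ are computed in the $B_\alpha$ containing $a$. Every dual weak brace is of this form. "$Y$ is bounded" means that $Y$ has a greatest element, denoted $1$. Distributor: for $T=S$ or $T=B_\alpha$, $\mathcal{D}_r(T)=\{z\in T\mid\forall a,b\in T\ (a+b)\circ z=a\circ z-z+b\circ z\}$. For $p\in\mathcal{D}_r(B_\alpha)$, $r_p$ denotes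 the solution $r_p(a,b)=(-a\circ p+a\circ b\circ p,\ (-a\circ p+a\circ b\circ p)^-\circ a\circ b)$ on $B_\alpha$. A solution on a set $X$ is a map $r:X\times X\to X\times X$ with $(r\times\mathrm{id})(\mathrm{id}\times r)(r\times\mathrm{id})=(\mathrm{id}\times r)(r\times\mathrm{id})(\mathrm{id}\times r)$. A map $r:S\times S\to S\times S$ is the strong semilattice of solutions $s_\alpha$ on $B_\alpha$ ($\alpha\in Y$) if $(\phi_{\alpha,\beta}\times\phi_{\alpha,\beta})s_\alpha=s_\beta(\phi_{\alpha,\beta}\times\phi_{\alpha,\beta})$ for all $\beta\le\alpha$ and $r(x,y)=s_{\alpha\beta}(\phi_{\alpha,\alpha\beta}(x),\phi_{\beta,\alpha\beta}(y))$ for all $x\in B_\alpha$, $y\in B_\beta$; $r$ is a strong semilattice of solutions if such a family $(s_\alpha)$ exists. Bite of parameters: a subset $P\subseteq S$ such that (1) $P\cap B_\alpha=\{p_\alpha\}\subseteq\mathcal{D}_r(B_\alpha)$ for every $\alpha\in Y$; (2) $a\circ p_\beta-a\circ p_\alpha=p_\beta-p_\alpha$ for all $\beta\le\alpha$ in $Y$ and $a\in B_\alpha$. $\mathcal{B}(S)$ is the family of all bites of parameters of $S$. *)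

theory Defs
  imports "HOL-Algebra.Ring"
begin

text \<open>
  A skew brace is carried by a record of type \<^typ>\<open>'a ring\<close>: the group \<open>(B,+)\<close> is
  \<open>add_monoid B\<close>, and the group \<open>(B,\<circ>)\<close> is the multiplicative reduct of \<open>B\<close>. The additive
  group need not be abelian, and \<open>B\<close> is not required to be a ring.
\<close>

definition skew_brace :: "('a, 'm) ring_scheme \<Rightarrow> bool" where
  "skew_brace B \<longleftrightarrow> group (add_monoid B) \<and> group B \<and>
     (\<forall>a\<in>carrier B. \<forall>b\<in>carrier B. \<forall>c\<in>carrier B.
        a \<otimes>\<^bsub>B\<^esub> (b \<oplus>\<^bsub>B\<^esub> c) = ((a \<otimes>\<^bsub>B\<^esub> b) \<ominus>\<^bsub>B\<^esub> a) \<oplus>\<^bsub>B\<^esub> (a \<otimes>\<^bsub>B\<^esub> c))"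

definition skew_brace_hom ::
    "('a, 'm) ring_scheme \<Rightarrow> ('b, 'n) ring_scheme \<Rightarrow> ('a \<Rightarrow> 'b) set" where
  "skew_brace_hom A B = hom (add_monoid A) (add_monoid B) \<inter> hom A B"

text \<open>
  In a dual weak brace both reducts are only inverse semigroups, so \<open>a_inv\<close> and \<open>m_inv\<close> do not
  apply to it. The following record carries the two inversions as operations; it serves both for
  the dual weak brace \<open>S\<close> and for the skew braces \<open>B \<alpha>\<close>.
\<close>

record 'a brace_ops = "'a partial_object" +
  bplus :: "['a, 'a] \<Rightarrow> 'a"  (infixl \<open>\<boxplus>\<index>\<close> 65)
  bneg :: "'a \<Rightarrow> 'a"
  bcirc :: "['a, 'a] \<Rightarrow> 'a"  (infixl \<open>\<odot>\<index>\<close> 70)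
  binv :: "'a \<Rightarrow> 'a"

definition bminus :: "('a, 'm) brace_ops_scheme \<Rightarrow> 'a \<Rightarrow> 'a \<Rightarrow> 'a"  (infixl \<open>\<boxminus>\<index>\<close> 65) where
  "a \<boxminus>\<^bsub>T\<^esub> b = a \<boxplus>\<^bsub>T\<^esub> bneg T b"

definition skew_brace_ops :: "('a, 'm) ring_scheme \<Rightarrow> 'a brace_ops" where
  "skew_brace_ops B =
     \<lparr>carrier = carrier B, bplus = add B, bneg = a_inv B, bcirc = mult B, binv = m_inv B\<rparr>"

definition distributor :: "('a, 'm) brace_ops_scheme \<Rightarrow> 'a set" where
  "distributor T = {z \<in> carrier T. \<forall>a\<in>carrier T. \<forall>b\<in>carrier T.
     (a \<boxplus>\<^bsub>T\<^esub> b) \<odot>\<^bsub>T\<^esub> z = a \<odot>\<^bsub>T\<^esub> z \<boxminus>\<^bsub>T\<^esub> z \<boxplus>\<^bsub>T\<^esub> b \<odot>\<^bsub>T\<^esub> z}"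

definition deformed_solution ::
    "('a, 'm) brace_ops_scheme \<Rightarrow> 'a \<Rightarrow> 'a \<times> 'a \<Rightarrow> 'a \<times> 'a" where
  "deformed_solution T z = (\<lambda>(a, b).
     (bneg T (a \<odot>\<^bsub>T\<^esub> z) \<boxplus>\<^bsub>T\<^esub> a \<odot>\<^bsub>T\<^esub> b \<odot>\<^bsub>T\<^esub> z,
      binv T (bneg T (a \<odot>\<^bsub>T\<^esub> z) \<boxplus>\<^bsub>T\<^esub> a \<odot>\<^bsub>T\<^esub> b \<odot>\<^bsub>T\<^esub> z) \<odot>\<^bsub>T\<^esub> a \<odot>\<^bsub>T\<^esub> b))"

text \<open>
  The semilattice \<open>Y\<close> is the index type \<open>'i\<close>, its product being \<^const>\<open>inf\<close>; \<open>\<phi> \<alpha> \<beta>\<close> is the map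
  from \<open>B \<alpha>\<close> to \<open>B \<beta>\<close>, constrained only for \<open>\<beta> \<le> \<alpha>\<close> and only on the carrier of \<open>B \<alpha>\<close>.
\<close>

locale skew_brace_semilattice =
  fixes B :: "'i::semilattice_inf \<Rightarrow> 'a ring"
    and \<phi> :: "'i \<Rightarrow> 'i \<Rightarrow> 'a \<Rightarrow> 'a"
  assumes brace: "skew_brace (B \<alpha>)"
    and disjoint: "\<alpha> \<noteq> \<beta> \<Longrightarrow> carrier (B \<alpha>) \<inter> carrier (B \<beta>) = {}"
    and phi_hom: "\<beta> \<le> \<alpha> \<Longrightarrow> \<phi> \<alpha> \<beta> \<in> skew_brace_hom (B \<alpha>) (B \<beta>)"
    and phi_id: "x \<in> carrier (B \<alpha>) \<Longrightarrow> \<phi> \<alpha> \<alpha> x = x"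
    and phi_comp: "\<gamma> \<le> \<beta> \<Longrightarrow> \<beta> \<le> \<alpha> \<Longrightarrow> x \<in> carrier (B \<alpha>) \<Longrightarrow> \<phi> \<beta> \<gamma> (\<phi> \<alpha> \<beta> x) = \<phi> \<alpha> \<gamma> x"

definition component :: "('i \<Rightarrow> 'a ring) \<Rightarrow> 'a \<Rightarrow> 'i" where
  "component B x = (THE \<alpha>. x \<in> carrier (B \<alpha>))"

definition dual_weak_brace ::
    "('i::semilattice_inf \<Rightarrow> 'a ring) \<Rightarrow> ('i \<Rightarrow> 'i \<Rightarrow> 'a \<Rightarrow> 'a) \<Rightarrow> 'a brace_ops" where
  "dual_weak_brace B \<phi> =
     \<lparr>carrier = (\<Union>\<alpha>. carrier (B \<alpha>)),
      bplus = (\<lambda>a b. let \<alpha> = component B a; \<beta> = component B b; \<gamma> = inf \<alpha> \<beta>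
                     in \<phi> \<alpha> \<gamma> a \<oplus>\<^bsub>B \<gamma>\<^esub> \<phi> \<beta> \<gamma> b),
      bneg = (\<lambda>a. \<ominus>\<^bsub>B (component B a)\<^esub> a),
      bcirc = (\<lambda>a b. let \<alpha> = component B a; \<beta> = component B b; \<gamma> = inf \<alpha> \<beta>
                     in \<phi> \<alpha> \<gamma> a \<otimes>\<^bsub>B \<gamma>\<^esub> \<phi> \<beta> \<gamma> b),
      binv = (\<lambda>a. inv\<^bsub>B (component B a)\<^esub> a)\<rparr>"

definition times_id :: "('a \<times> 'a \<Rightarrow> 'a \<times> 'a) \<Rightarrow> 'a \<times> 'a \<times> 'a \<Rightarrow> 'a \<times> 'a \<times> 'a" where
  "times_id r = (\<lambda>(x, y, z). (fst (r (x, y)), snd (r (x, y)), z))"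

definition id_times :: "('a \<times> 'a \<Rightarrow> 'a \<times> 'a) \<Rightarrow> 'a \<times> 'a \<times> 'a \<Rightarrow> 'a \<times> 'a \<times> 'a" where
  "id_times r = map_prod id r"

definition solution_on :: "'a set \<Rightarrow> ('a \<times> 'a \<Rightarrow> 'a \<times> 'a) \<Rightarrow> bool" where
  "solution_on X r \<longleftrightarrow> r \<in> X \<times> X \<rightarrow> X \<times> X \<and>
     (\<forall>t \<in> X \<times> X \<times> X.
        (times_id r \<circ> id_times r \<circ> times_id r) t = (id_times r \<circ> times_id r \<circ> id_times r) t)"

definition strong_semilattice_of ::
    "('i::semilattice_inf \<Rightarrow> 'a ring) \<Rightarrow> ('i \<Rightarrow> 'i \<Rightarrow> 'a \<Rightarrow> 'a) \<Rightarrow>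
     ('i \<Rightarrow> 'a \<times> 'a \<Rightarrow> 'a \<times> 'a) \<Rightarrow> ('a \<times> 'a \<Rightarrow> 'a \<times> 'a) \<Rightarrow> bool" where
  "strong_semilattice_of B \<phi> s r \<longleftrightarrow>
     r \<in> (\<Union>\<alpha>. carrier (B \<alpha>)) \<times> (\<Union>\<alpha>. carrier (B \<alpha>)) \<rightarrow>
         (\<Union>\<alpha>. carrier (B \<alpha>)) \<times> (\<Union>\<alpha>. carrier (B \<alpha>)) \<and>
     (\<forall>\<alpha>. solution_on (carrier (B \<alpha>)) (s \<alpha>)) \<and>
     (\<forall>\<alpha> \<beta>. \<beta> \<le> \<alpha> \<longrightarrow> (\<forall>t \<in> carrier (B \<alpha>) \<times> carrier (B \<alpha>).
        map_prod (\<phi> \<alpha> \<beta>) (\<phi> \<alpha> \<beta>) (s \<alpha> t) = s \<beta> (map_prod (\<phi> \<alpha> \<beta>) (\<phi> \<alpha> \<beta>) t))) \<and>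
     (\<forall>\<alpha> \<beta>. \<forall>x\<in>carrier (B \<alpha>). \<forall>y\<in>carrier (B \<beta>).
        r (x, y) = s (inf \<alpha> \<beta>) (\<phi> \<alpha> (inf \<alpha> \<beta>) x, \<phi> \<beta> (inf \<alpha> \<beta>) y))"

definition is_strong_semilattice ::
    "('i::semilattice_inf \<Rightarrow> 'a ring) \<Rightarrow> ('i \<Rightarrow> 'i \<Rightarrow> 'a \<Rightarrow> 'a) \<Rightarrow>
     ('a \<times> 'a \<Rightarrow> 'a \<times> 'a) \<Rightarrow> bool" where
  "is_strong_semilattice B \<phi> r \<longleftrightarrow> (\<exists>s. strong_semilattice_of B \<phi> s r)"

definition bites ::
    "('i::semilattice_inf \<Rightarrow> 'a ring) \<Rightarrow> ('i \<Rightarrow> 'i \<Rightarrow> 'a \<Rightarrow> 'a) \<Rightarrow> 'a set set" where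
  "bites B \<phi> = (let S = dual_weak_brace B \<phi> in
     {P. P \<subseteq> carrier S \<and>
        (\<exists>p. (\<forall>\<alpha>. P \<inter> carrier (B \<alpha>) = {p \<alpha>} \<and> {p \<alpha>} \<subseteq> distributor (skew_brace_ops (B \<alpha>))) \<and>
             (\<forall>\<alpha> \<beta>. \<beta> \<le> \<alpha> \<longrightarrow> (\<forall>a\<in>carrier (B \<alpha>).
                a \<odot>\<^bsub>S\<^esub> p \<beta> \<boxminus>\<^bsub>S\<^esub> a \<odot>\<^bsub>S\<^esub> p \<alpha> = p \<beta> \<boxminus>\<^bsub>S\<^esub> p \<alpha>)))})"

definition is_greatest_index :: "'i::order \<Rightarrow> bool" where
  "is_greatest_index e \<longleftrightarrow> (\<forall>\<alpha>. \<alpha> \<le> e)"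

end

theory Submission
  imports Defs
begin

text \<open>
  If \<open>z\<close> lies in \<open>B \<delta>\<close>, then the first component of \<open>r\<^sub>z (a, a)\<close> for \<open>a \<in> B \<alpha>\<close> lies in \<open>B (inf \<alpha> \<delta>)\<close>,
  whereas a strong semilattice of solutions maps \<open>B \<alpha> \<times> B \<alpha>\<close> to itself. Disjointness forces
  \<open>\<alpha> \<le> \<delta>\<close> for every \<open>\<alpha>\<close>, so \<open>\<delta>\<close> is the greatest element. In that case \<open>r\<^sub>z\<close> agrees on
  \<open>B \<alpha> \<times> B \<alpha>\<close> with the solution deformed by \<open>\<phi> \<delta> \<alpha> z\<close>. The given solutions on the components are
  restrictions of \<open>r\<^sub>z\<close>, so they coincide there with these deformed solutions, which thereby
  inherit the Yang-Baxter equation without a computation.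
\<close>

text \<open>The Yang-Baxter equation evaluates a map only inside \<open>X \<times> X\<close>,
  because a solution keeps every intermediate triple in \<open>X \<times> X \<times> X\<close>.
  Values outside are irrelevant.\<close>

lemma solution_on_cong:
  assumes "solution_on X r" and eq: "\<And>t. t \<in> X \<times> X \<Longrightarrow> r' t = r t"
  shows "solution_on X r'"
proof -
  have r: "r \<in> X \<times> X \<rightarrow> X \<times> X"
    and yb: "\<And>t. t \<in> X \<times> X \<times> X \<Longrightarrow>
      times_id r (id_times r (times_id r t)) = id_times r (times_id r (id_times r t))"
    using assms(1) by (auto simp: solution_on_def)
  \<comment> \<open>Agreement is paired with invariance so that \<open>r'\<close> can be replaced by
    \<open>r\<close> in each of the three composed factors in turn.\<close>
  have 1: "times_id r' t = times_id r t \<and> times_id r t \<in> X \<times> X \<times> X"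
    and 2: "id_times r' t = id_times r t \<and> id_times r t \<in> X \<times> X \<times> X"
    if t: "t \<in> X \<times> X \<times> X" for t
  proof -
    obtain x y w where [simp]: "t = (x, y, w)" and xyw: "x \<in> X" "y \<in> X" "w \<in> X"
      using t by auto
    have "r (x, y) \<in> X \<times> X" "r (y, w) \<in> X \<times> X"
      using r xyw by auto
    then show "times_id r' t = times_id r t \<and> times_id r t \<in> X \<times> X \<times> X"
      and "id_times r' t = id_times r t \<and> id_times r t \<in> X \<times> X \<times> X"
      using xyw eq by (auto simp: times_id_def id_times_def mem_Times_iff)
  qed
  show ?thesis
    unfolding solution_on_def
    using r eq yb by (auto simp: 1 2 Pi_iff simp del: mem_Sigma_iff)
qed

section \<open>Arithmetic in the components and the operations of \<open>S\<close>\<close>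

context skew_brace_semilattice
begin

abbreviation "S \<equiv> dual_weak_brace B \<phi>"

lemma add_group: "group (add_monoid (B \<alpha>))" and mult_group: "group (B \<alpha>)"
  using brace[of \<alpha>] by (auto simp: skew_brace_def)

lemma add_closed [simp]:
  "x \<in> carrier (B \<alpha>) \<Longrightarrow> y \<in> carrier (B \<alpha>) \<Longrightarrow> x \<oplus>\<^bsub>B \<alpha>\<^esub> y \<in> carrier (B \<alpha>)"
  using group.is_monoid[OF add_group[of \<alpha>], THEN monoid.m_closed] by simp

lemma neg_closed [simp]: "x \<in> carrier (B \<alpha>) \<Longrightarrow> \<ominus>\<^bsub>B \<alpha>\<^esub> x \<in> carrier (B \<alpha>)"
  using group.inv_closed[OF add_group[of \<alpha>]] by (simp add: a_inv_def)

lemma mult_closed [simp]: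
  "x \<in> carrier (B \<alpha>) \<Longrightarrow> y \<in> carrier (B \<alpha>) \<Longrightarrow> x \<otimes>\<^bsub>B \<alpha>\<^esub> y \<in> carrier (B \<alpha>)"
  by (rule monoid.m_closed[OF group.is_monoid[OF mult_group]])

lemma inv_closed [simp]: "x \<in> carrier (B \<alpha>) \<Longrightarrow> inv\<^bsub>B \<alpha>\<^esub> x \<in> carrier (B \<alpha>)"
  by (rule group.inv_closed[OF mult_group])

lemma phi_closed [simp]: "\<beta> \<le> \<alpha> \<Longrightarrow> x \<in> carrier (B \<alpha>) \<Longrightarrow> \<phi> \<alpha> \<beta> x \<in> carrier (B \<beta>)"
  using phi_hom[of \<beta> \<alpha>] by (auto simp: skew_brace_hom_def hom_def)

lemma phi_neg:
  assumes "\<beta> \<le> \<alpha>" "x \<in> carrier (B \<alpha>)"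
  shows "\<phi> \<alpha> \<beta> (\<ominus>\<^bsub>B \<alpha>\<^esub> x) = \<ominus>\<^bsub>B \<beta>\<^esub> \<phi> \<alpha> \<beta> x"
proof -
  have "group_hom (add_monoid (B \<alpha>)) (add_monoid (B \<beta>)) (\<phi> \<alpha> \<beta>)"
    using add_group phi_hom[OF assms(1)]
    by (auto simp: group_hom_def group_hom_axioms_def skew_brace_hom_def)
  then show ?thesis
    using group_hom.hom_inv[of "add_monoid (B \<alpha>)" "add_monoid (B \<beta>)" "\<phi> \<alpha> \<beta>" x] assms(2)
    by (simp add: a_inv_def)
qed

lemma component_unique:
  "x \<in> carrier (B \<alpha>) \<Longrightarrow> x \<in> carrier (B \<beta>) \<Longrightarrow> \<alpha> = \<beta>"
  using disjoint[of \<alpha> \<beta>] by auto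

lemma component_eq: "x \<in> carrier (B \<alpha>) \<Longrightarrow> component B x = \<alpha>"
  unfolding component_def using component_unique by blast

lemma carrier_dual_weak_brace: "carrier S = (\<Union>\<alpha>. carrier (B \<alpha>))"
  by (simp add: dual_weak_brace_def)

lemma bplus_dual_weak_brace:
  assumes "x \<in> carrier (B \<alpha>)" "y \<in> carrier (B \<beta>)"
  shows "x \<boxplus>\<^bsub>S\<^esub> y = \<phi> \<alpha> (inf \<alpha> \<beta>) x \<oplus>\<^bsub>B (inf \<alpha> \<beta>)\<^esub> \<phi> \<beta> (inf \<alpha> \<beta>) y"
  using assms by (simp add: dual_weak_brace_def component_eq Let_def)

lemma bcirc_dual_weak_brace:
  assumes "x \<in> carrier (B \<alpha>)" "y \<in> carrier (B \<beta>)"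
  shows "x \<odot>\<^bsub>S\<^esub> y = \<phi> \<alpha> (inf \<alpha> \<beta>) x \<otimes>\<^bsub>B (inf \<alpha> \<beta>)\<^esub> \<phi> \<beta> (inf \<alpha> \<beta>) y"
  using assms by (simp add: dual_weak_brace_def component_eq Let_def)

lemma bneg_dual_weak_brace: "x \<in> carrier (B \<alpha>) \<Longrightarrow> bneg S x = \<ominus>\<^bsub>B \<alpha>\<^esub> x"
  by (simp add: dual_weak_brace_def component_eq)

lemma binv_dual_weak_brace: "x \<in> carrier (B \<alpha>) \<Longrightarrow> binv S x = inv\<^bsub>B \<alpha>\<^esub> x"
  by (simp add: dual_weak_brace_def component_eq)

text \<open>The infimum is \<alpha>, so only \<open>y\<close> is transported. This is the case in
  which a term from the component of the parameter meets a lower component.\<close>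

lemma bplus_le:
  assumes "x \<in> carrier (B \<alpha>)" "y \<in> carrier (B \<beta>)" "\<alpha> \<le> \<beta>"
  shows "x \<boxplus>\<^bsub>S\<^esub> y = x \<oplus>\<^bsub>B \<alpha>\<^esub> \<phi> \<beta> \<alpha> y"
  using bplus_dual_weak_brace[OF assms(1,2)] assms by (simp add: inf_absorb1 phi_id)

lemma bplus_same:
  assumes "x \<in> carrier (B \<alpha>)" "y \<in> carrier (B \<alpha>)"
  shows "x \<boxplus>\<^bsub>S\<^esub> y = x \<oplus>\<^bsub>B \<alpha>\<^esub> y"
  using bplus_le[OF assms] assms by (simp add: phi_id)

lemma bcirc_le:
  assumes "x \<in> carrier (B \<alpha>)" "y \<in> carrier (B \<beta>)" "\<alpha> \<le> \<beta>"
  shows "x \<odot>\<^bsub>S\<^esub> y = x \<otimes>\<^bsub>B \<alpha>\<^esub> \<phi> \<beta> \<alpha> y"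
  using bcirc_dual_weak_brace[OF assms(1,2)] assms by (simp add: inf_absorb1 phi_id)

lemma bcirc_same:
  assumes "x \<in> carrier (B \<alpha>)" "y \<in> carrier (B \<alpha>)"
  shows "x \<odot>\<^bsub>S\<^esub> y = x \<otimes>\<^bsub>B \<alpha>\<^esub> y"
  using bcirc_le[OF assms] assms by (simp add: phi_id)

text \<open>Subtraction in \<open>S\<close> first transports \<open>x\<close> down to
  \<open>B \<beta>\<close>, and \<phi> commutes with negation, so an element is subtracted from
  itself there.\<close>

lemma bminus_self:
  assumes "\<beta> \<le> \<alpha>" "x \<in> carrier (B \<alpha>)"
  shows "\<phi> \<alpha> \<beta> x \<boxminus>\<^bsub>S\<^esub> x = \<zero>\<^bsub>B \<beta>\<^esub>"
proof -
  have "\<phi> \<alpha> \<beta> x \<oplus>\<^bsub>B \<beta>\<^esub> \<ominus>\<^bsub>B \<beta>\<^esub> \<phi> \<alpha> \<beta> x = \<zero>\<^bsub>B \<beta>\<^esub>"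
    using group.r_inv[OF add_group[of \<beta>], of "\<phi> \<alpha> \<beta> x"] assms by (simp add: a_inv_def)
  then show ?thesis
    using assms by (simp add: bminus_def bneg_dual_weak_brace
        bplus_le[where \<alpha>=\<beta> and \<beta>=\<alpha>] phi_neg)
qed

text \<open>Against elements of \<open>B \<alpha>\<close>, both \<open>z\<close> and its negative
  act only through their images under \<open>\<phi> \<delta> \<alpha>\<close>, so the identity in
  \<open>S\<close> restricts to the required one.\<close>

lemma distributor_component:
  assumes z: "z \<in> distributor S" "z \<in> carrier (B \<delta>)" and le: "\<alpha> \<le> \<delta>"
  shows "\<phi> \<delta> \<alpha> z \<in> distributor (skew_brace_ops (B \<alpha>))"
proof -
  have "(a \<oplus>\<^bsub>B \<alpha>\<^esub> b) \<otimes>\<^bsub>B \<alpha>\<^esub> \<phi> \<delta> \<alpha> z =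
      a \<otimes>\<^bsub>B \<alpha>\<^esub> \<phi> \<delta> \<alpha> z \<oplus>\<^bsub>B \<alpha>\<^esub> \<ominus>\<^bsub>B \<alpha>\<^esub> \<phi> \<delta> \<alpha> z \<oplus>\<^bsub>B \<alpha>\<^esub> b \<otimes>\<^bsub>B \<alpha>\<^esub> \<phi> \<delta> \<alpha> z"
    if ab: "a \<in> carrier (B \<alpha>)" "b \<in> carrier (B \<alpha>)" for a b
  proof -
    have "(a \<boxplus>\<^bsub>S\<^esub> b) \<odot>\<^bsub>S\<^esub> z = a \<odot>\<^bsub>S\<^esub> z \<boxminus>\<^bsub>S\<^esub> z \<boxplus>\<^bsub>S\<^esub> b \<odot>\<^bsub>S\<^esub> z"
      using z(1) ab by (auto simp: distributor_def carrier_dual_weak_brace)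
    then show ?thesis
      using ab z(2) le
      by (simp add: bminus_def bneg_dual_weak_brace[OF z(2)] bplus_same[where \<alpha>=\<alpha>]
          bplus_le[where \<alpha>=\<alpha> and \<beta>=\<delta>] bcirc_le[where \<alpha>=\<alpha> and \<beta>=\<delta>] phi_neg)
  qed
  then show ?thesis
    using z(2) le by (simp add: distributor_def skew_brace_ops_def bminus_def)
qed

lemma deformed_solution_component:
  assumes "z \<in> carrier (B \<delta>)" "\<alpha> \<le> \<delta>" "t \<in> carrier (B \<alpha>) \<times> carrier (B \<alpha>)"
  shows "deformed_solution S z t =
    deformed_solution (skew_brace_ops (B \<alpha>)) (\<phi> \<delta> \<alpha> z) t"
  using assms
  by (auto simp: deformed_solution_def skew_brace_ops_def bcirc_same[where \<alpha>=\<alpha>]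
      bcirc_le[where \<alpha>=\<alpha> and \<beta>=\<delta>] bneg_dual_weak_brace[where \<alpha>=\<alpha>]
      binv_dual_weak_brace[where \<alpha>=\<alpha>] bplus_same[where \<alpha>=\<alpha>])

text \<open>Multiplying any element of \<open>B \<alpha>\<close> by \<open>z\<close> lands in the
  infimum component, and the first entry combines two such products. No comparability of \<alpha>
  and \<delta> is assumed, so the lemma can be used to derive it.\<close>

lemma fst_deformed_solution_mem:
  assumes z: "z \<in> carrier (B \<delta>)" and a: "a \<in> carrier (B \<alpha>)" and b: "b \<in> carrier (B \<alpha>)"
  shows "fst (deformed_solution S z (a, b)) \<in> carrier (B (inf \<alpha> \<delta>))"
proof -
  have mem: "c \<odot>\<^bsub>S\<^esub> z \<in> carrier (B (inf \<alpha> \<delta>))" if "c \<in> carrier (B \<alpha>)" for c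
    using bcirc_dual_weak_brace[OF that z] that z by simp
  show ?thesis
    using mem[OF a] mem[of "a \<odot>\<^bsub>S\<^esub> b"] a b
    by (simp add: deformed_solution_def bcirc_same[where \<alpha>=\<alpha>]
        bneg_dual_weak_brace[where \<alpha>="inf \<alpha> \<delta>"] bplus_same[where \<alpha>="inf \<alpha> \<delta>"])
qed

section \<open>Families of solutions glued along the semilattice\<close>

text \<open>For two equal indices the transport maps in the gluing formula are identities, so
  \<open>r\<close> determines the family on the carriers.\<close>

lemma strong_semilattice_of_restrict:
  assumes "strong_semilattice_of B \<phi> s r" "t \<in> carrier (B \<alpha>) \<times> carrier (B \<alpha>)"
  shows "s \<alpha> t = r t"
proof -
  obtain x y where t: "t = (x, y)" and xy: "x \<in> carrier (B \<alpha>)" "y \<in> carrier (B \<alpha>)"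
    using assms(2) by auto
  have "r (x, y) = s (inf \<alpha> \<alpha>) (\<phi> \<alpha> (inf \<alpha> \<alpha>) x, \<phi> \<alpha> (inf \<alpha> \<alpha>) y)"
    using assms(1) xy unfolding strong_semilattice_of_def by blast
  then show ?thesis
    using t xy by (simp add: phi_id)
qed

text \<open>All conditions on the family concern arguments in the carriers, and \<phi> maps carriers
  to carriers, so the family may be exchanged for one that agrees there.\<close>

lemma strong_semilattice_of_cong:
  assumes s: "strong_semilattice_of B \<phi> s r"
    and eq: "\<And>\<alpha> t. t \<in> carrier (B \<alpha>) \<times> carrier (B \<alpha>) \<Longrightarrow> s' \<alpha> t = s \<alpha> t"
  shows "strong_semilattice_of B \<phi> s' r"
proof -
  have "solution_on (carrier (B \<alpha>)) (s' \<alpha>)" for \<alpha>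
  proof (rule solution_on_cong)
    show "solution_on (carrier (B \<alpha>)) (s \<alpha>)"
      using s by (simp add: strong_semilattice_of_def)
  qed (rule eq)
  moreover have "map_prod (\<phi> \<alpha> \<beta>) (\<phi> \<alpha> \<beta>) (s' \<alpha> t) = s' \<beta> (map_prod (\<phi> \<alpha> \<beta>) (\<phi> \<alpha> \<beta>) t)"
    if "\<beta> \<le> \<alpha>" "t \<in> carrier (B \<alpha>) \<times> carrier (B \<alpha>)" for \<alpha> \<beta> t
  proof -
    have "map_prod (\<phi> \<alpha> \<beta>) (\<phi> \<alpha> \<beta>) t \<in> carrier (B \<beta>) \<times> carrier (B \<beta>)"
      using that by auto
    moreover have "map_prod (\<phi> \<alpha> \<beta>) (\<phi> \<alpha> \<beta>) (s \<alpha> t) = s \<beta> (map_prod (\<phi> \<alpha> \<beta>) (\<phi> \<alpha> \<beta>) t)"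
      using s that unfolding strong_semilattice_of_def by blast
    ultimately show ?thesis
      using that eq by simp
  qed
  moreover have "r (x, y) = s' (inf \<alpha> \<beta>) (\<phi> \<alpha> (inf \<alpha> \<beta>) x, \<phi> \<beta> (inf \<alpha> \<beta>) y)"
    if "x \<in> carrier (B \<alpha>)" "y \<in> carrier (B \<beta>)" for \<alpha> \<beta> x y
    using s that eq unfolding strong_semilattice_of_def by simp
  ultimately show ?thesis
    using s unfolding strong_semilattice_of_def by (intro conjI allI ballI impI) simp_all
qed

lemma strong_semilattice_imp_greatest:
  assumes "is_strong_semilattice B \<phi> (deformed_solution S z)" and z: "z \<in> carrier (B \<delta>)"
  shows "is_greatest_index \<delta>"
  unfolding is_greatest_index_def
proof
  fix \<alpha>
  obtain s where s: "strong_semilattice_of B \<phi> s (deformed_solution S z)"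
    using assms(1) by (auto simp: is_strong_semilattice_def)
  \<comment> \<open>The neutral element shows that the component is inhabited; disjointness can
    separate indices only through an actual element.\<close>
  obtain a where a: "a \<in> carrier (B \<alpha>)"
    using monoid.one_closed[OF group.is_monoid[OF mult_group]] by blast
  have "s \<alpha> (a, a) \<in> carrier (B \<alpha>) \<times> carrier (B \<alpha>)"
    using s a by (auto simp: strong_semilattice_of_def solution_on_def)
  then have "fst (deformed_solution S z (a, a)) \<in> carrier (B \<alpha>)"
    using strong_semilattice_of_restrict[OF s, of "(a, a)" \<alpha>] a by (simp add: mem_Times_iff)
  then have "\<alpha> = inf \<alpha> \<delta>"
    using fst_deformed_solution_mem[OF z a a] component_unique by blast
  then show "\<alpha> \<le> \<delta>"
    by (simp add: le_iff_inf)
qed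

text \<open>Both sides of the second bite condition are the zero of \<open>B \<beta>\<close>: each
  subtracts an element of \<open>B \<alpha>\<close> from its own image under
  \<open>\<phi> \<alpha> \<beta>\<close>.\<close>

lemma phi_images_mem_bites:
  assumes e: "is_greatest_index e" and z: "z \<in> distributor S" "z \<in> carrier (B e)"
  shows "{\<phi> e \<alpha> z | \<alpha>. True} \<in> bites B \<phi>"
proof -
  let ?P = "{\<phi> e \<alpha> z | \<alpha>. True}"
  have le: "\<alpha> \<le> e" for \<alpha>
    using e by (simp add: is_greatest_index_def)
  have p: "\<phi> e \<alpha> z \<in> carrier (B \<alpha>)" for \<alpha>
    using z(2) le by simp
  have "?P \<inter> carrier (B \<alpha>) = {\<phi> e \<alpha> z}" for \<alpha>
    using p component_unique by blast
  moreover have "?P \<subseteq> carrier S"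
    using p by (auto simp: carrier_dual_weak_brace)
  moreover have "a \<odot>\<^bsub>S\<^esub> \<phi> e \<beta> z \<boxminus>\<^bsub>S\<^esub> a \<odot>\<^bsub>S\<^esub> \<phi> e \<alpha> z = \<phi> e \<beta> z \<boxminus>\<^bsub>S\<^esub> \<phi> e \<alpha> z"
    if "\<beta> \<le> \<alpha>" "a \<in> carrier (B \<alpha>)" for \<alpha> \<beta> a
  proof -
    have comp: "\<phi> \<alpha> \<beta> (\<phi> e \<alpha> z) = \<phi> e \<beta> z"
      using phi_comp le that z(2) by blast
    have "\<phi> \<alpha> \<beta> (a \<otimes>\<^bsub>B \<alpha>\<^esub> \<phi> e \<alpha> z) = \<phi> \<alpha> \<beta> a \<otimes>\<^bsub>B \<beta>\<^esub> \<phi> e \<beta> z"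
      using phi_hom[OF that(1)] that(2) p comp by (auto simp: skew_brace_hom_def hom_def)
    \<comment> \<open>The product in \<open>S\<close> transports \<open>a\<close> to
      \<open>B \<beta>\<close>, and \<phi> is multiplicative; this puts the left side into the form
      of \<open>bminus_self\<close>.\<close>
    then have "a \<odot>\<^bsub>S\<^esub> \<phi> e \<beta> z = \<phi> \<alpha> \<beta> (a \<odot>\<^bsub>S\<^esub> \<phi> e \<alpha> z)"
      using that p bcirc_dual_weak_brace[OF that(2) p[of \<beta>]] bcirc_same[OF that(2) p[of \<alpha>]]
      by (simp add: inf_absorb2 phi_id)
    moreover have "a \<odot>\<^bsub>S\<^esub> \<phi> e \<alpha> z \<in> carrier (B \<alpha>)"
      using that p by (simp add: bcirc_same[where \<alpha>=\<alpha>])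
    ultimately show ?thesis
      using bminus_self[OF that(1)] p comp by metis
  qed
  ultimately show ?thesis
    using distributor_component[OF z le]
    unfolding bites_def Let_def by (auto intro!: exI[of _ "\<lambda>\<alpha>. \<phi> e \<alpha> z"])
qed

end

theorem theorem4p7:
  fixes B :: "'i::semilattice_inf \<Rightarrow> 'a ring"
    and \<phi> :: "'i \<Rightarrow> 'i \<Rightarrow> 'a \<Rightarrow> 'a"
    and z :: 'a
  assumes "skew_brace_semilattice B \<phi>"
    and "z \<in> distributor (dual_weak_brace B \<phi>)"
  shows "((\<nexists>e::'i. is_greatest_index e) \<or> (\<exists>e::'i. is_greatest_index e \<and> z \<notin> carrier (B e)) \<longrightarrow>
            \<not> is_strong_semilattice B \<phi> (deformed_solution (dual_weak_brace B \<phi>) z)) \<and>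
         (\<forall>e::'i. is_greatest_index e \<and>
            is_strong_semilattice B \<phi> (deformed_solution (dual_weak_brace B \<phi>) z) \<longrightarrow>
            z \<in> carrier (B e) \<and>
            {\<phi> e \<alpha> z | \<alpha>. True} \<in> bites B \<phi> \<and>
            strong_semilattice_of B \<phi>
              (\<lambda>\<alpha>. deformed_solution (skew_brace_ops (B \<alpha>)) (\<phi> e \<alpha> z))
              (deformed_solution (dual_weak_brace B \<phi>) z))"
proof -
  interpret skew_brace_semilattice B \<phi>
    by (rule assms(1))
  let ?r = "deformed_solution S z"
  obtain \<delta> where z: "z \<in> carrier (B \<delta>)"
    using assms(2) by (auto simp: distributor_def carrier_dual_weak_brace)
  \<comment> \<open>Two greatest indices coincide by antisymmetry, so both claims reduce to the
    index \<delta> of the component containing \<open>z\<close>.\<close>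
  have greatest: "e = \<delta>" if "is_strong_semilattice B \<phi> ?r" "is_greatest_index e" for e
    using strong_semilattice_imp_greatest[OF that(1) z] that(2)
    by (simp add: is_greatest_index_def order.eq_iff)
  have part2: "{\<phi> \<delta> \<alpha> z | \<alpha>. True} \<in> bites B \<phi> \<and> strong_semilattice_of B \<phi>
      (\<lambda>\<alpha>. deformed_solution (skew_brace_ops (B \<alpha>)) (\<phi> \<delta> \<alpha> z)) ?r"
    if r: "is_strong_semilattice B \<phi> ?r"
  proof
    have \<delta>: "is_greatest_index \<delta>"
      by (rule strong_semilattice_imp_greatest[OF r z])
    then show "{\<phi> \<delta> \<alpha> z | \<alpha>. True} \<in> bites B \<phi>"
      by (rule phi_images_mem_bites[OF _ assms(2) z])
    obtain s where s: "strong_semilattice_of B \<phi> s ?r"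
      using r by (auto simp: is_strong_semilattice_def)
    show "strong_semilattice_of B \<phi>
        (\<lambda>\<alpha>. deformed_solution (skew_brace_ops (B \<alpha>)) (\<phi> \<delta> \<alpha> z)) ?r"
    proof (rule strong_semilattice_of_cong[OF s])
      fix \<alpha> t
      assume t: "t \<in> carrier (B \<alpha>) \<times> carrier (B \<alpha>)"
      have "\<alpha> \<le> \<delta>"
        using \<delta> by (simp add: is_greatest_index_def)
      \<comment> \<open>Both sides equal \<open>?r t\<close>.\<close>
      then show "deformed_solution (skew_brace_ops (B \<alpha>)) (\<phi> \<delta> \<alpha> z) t = s \<alpha> t"
        using deformed_solution_component[OF z _ t] strong_semilattice_of_restrict[OF s t] by simp
    qed
  qed
  show ?thesis
  proof (rule conjI; (intro allI)?; rule impI)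
    assume no: "(\<nexists>e::'i. is_greatest_index e) \<or> (\<exists>e::'i. is_greatest_index e \<and> z \<notin> carrier (B e))"
    show "\<not> is_strong_semilattice B \<phi> ?r"
    proof
      assume r: "is_strong_semilattice B \<phi> ?r"
      \<comment> \<open>Since \<delta> is greatest, the unbounded alternative is excluded and only
        the second one remains.\<close>
      obtain e where e: "is_greatest_index e" "z \<notin> carrier (B e)"
        using no strong_semilattice_imp_greatest[OF r z] by blast
      then show False
        using greatest[OF r e(1)] z by simp
    qed
  next
    fix e :: 'i
    assume "is_greatest_index e \<and> is_strong_semilattice B \<phi> ?r"
    then have r: "is_strong_semilattice B \<phi> ?r" and "is_greatest_index e"
      by simp_all
    then have e: "e = \<delta>"
      by (rule greatest)
    show "z \<in> carrier (B e) \<and> {\<phi> e \<alpha> z | \<alpha>. True} \<in> bites B \<phi> \<and>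
        strong_semilattice_of B \<phi>
          (\<lambda>\<alpha>. deformed_solution (skew_brace_ops (B \<alpha>)) (\<phi> e \<alpha> z)) ?r"
      unfolding e by (rule conjI[OF z part2[OF r]])
  qed
qed

end
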